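(* Let $F$ and $L$ be two infinite $2$-regular graphs. Then there exists a solution to the Oberwolfach problem $OP(F)$ that admits a subsystem relative to $L$ if and only if $F$ contains a copy $\tilde{L}$ of $L$ (a subgraph of $F$ isomorphic to $L$) such that either $\tilde{L}=F$ or $|V(F)\setminus V(\tilde{L})|=|V(F)|$.
   Context: Graphs are simple and without loops, finite or infinite; set theory is ZFC. $V(\Lambda)$ denotes the vertex set of $\Lambda$, and $\mathbb{K}_V$ is the complete graph with vertex set $V$. A graph is $2$-regular if every vertex has degree $2$. A spanning subgraph of $\Lambda$ is a subgraph with the same vertex set as $\Lambda$. For a $2$-regular graph $F$, a solution to $OP(F)$ over $\mathbb{K}_V$ (where $|V|=|V(F)|$) is a set of spanning subgraphs of $\mathbb{K}_V$, each isomorphic to $F$, such that each edge of $\mathbb{K}_V$ belongs to exactly one of them. Given a solution $\mathfrak{F}$ to $OP(F)$ over $\mathbb{K}_V$, a subsystem of $\mathfrak{F}$ relative to $L$ is a solution $\mathfrak{L}$ to $OP(L)$ over $\mathbb{K}_W$, for some $W\subseteq V$ (with $W=V$ allowed), such that $\mathfrak{L}$ is the restriction of $\mathfrak{F}$ to $\mathbb{K}_W$; that is, $\mathfrak{L}$ consists exactly of those subgraphs induced on $W$ by the members of $\mathfrak{F}$ which have at least one edge. *)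

theory Defs
  imports Main "HOL-Library.Equipollence"
begin

datatype 'a graph = Graph (verts: "'a set") (edges: "'a set set")

definition simple_graph :: "'a graph \<Rightarrow> bool" where
  "simple_graph G \<longleftrightarrow> (\<forall>e\<in>edges G. e \<subseteq> verts G \<and> card e = 2)"

definition complete_graph :: "'a set \<Rightarrow> 'a graph" where
  "complete_graph V = Graph V {e. e \<subseteq> V \<and> card e = 2}"

(* card is 0 on infinite sets, so for k > 0 the equation below
   entails that only finitely many edges meet v. *)
definition regular :: "nat \<Rightarrow> 'a graph \<Rightarrow> bool" where
  "regular k G \<longleftrightarrow> (\<forall>v\<in>verts G. card {e \<in> edges G. v \<in> e} = k)"

definition subgraph :: "'a graph \<Rightarrow> 'a graph \<Rightarrow> bool" where
  "subgraph H G \<longleftrightarrow> simple_graph H \<and> verts H \<subseteq> verts G \<and> edges H \<subseteq> edges G"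

definition spanning_subgraph :: "'a graph \<Rightarrow> 'a graph \<Rightarrow> bool" where
  "spanning_subgraph H G \<longleftrightarrow> subgraph H G \<and> verts H = verts G"

definition induced_subgraph :: "'a graph \<Rightarrow> 'a set \<Rightarrow> 'a graph" where
  "induced_subgraph G W = Graph (verts G \<inter> W) {e \<in> edges G. e \<subseteq> W}"

definition isomorphic :: "'a graph \<Rightarrow> 'b graph \<Rightarrow> bool" where
  "isomorphic G H \<longleftrightarrow> (\<exists>f. bij_betw f (verts G) (verts H) \<and>
     (\<forall>u\<in>verts G. \<forall>v\<in>verts G. {u, v} \<in> edges G \<longleftrightarrow> {f u, f v} \<in> edges H))"

(* The equipollence is not redundant: if V has at most one vertex, the empty
   set of subgraphs satisfies the other two conditions for every F. *)
definition OP_solution :: "'a graph \<Rightarrow> 'v set \<Rightarrow> 'v graph set \<Rightarrow> bool" where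
  "OP_solution F V \<FF> \<longleftrightarrow> V \<approx> verts F \<and>
     (\<forall>G\<in>\<FF>. spanning_subgraph G (complete_graph V) \<and> isomorphic G F) \<and>
     (\<forall>e\<in>edges (complete_graph V). \<exists>!G. G \<in> \<FF> \<and> e \<in> edges G)"

definition restriction :: "'v graph set \<Rightarrow> 'v set \<Rightarrow> 'v graph set" where
  "restriction \<FF> W =
     {H. (\<exists>G\<in>\<FF>. H = induced_subgraph G W) \<and> edges H \<noteq> {}}"

definition subsystem :: "'b graph \<Rightarrow> 'v set \<Rightarrow> 'v graph set \<Rightarrow> 'v graph set \<Rightarrow> bool" where
  "subsystem L V \<FF> \<LL> \<longleftrightarrow>
     (\<exists>W\<subseteq>V. OP_solution L W \<LL> \<and> \<LL> = restriction \<FF> W)"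

end

theory Submission
  imports Defs
begin

text \<open>
  If a member of a solution has no edge inside \<open>W\<close>, then every vertex of \<open>W\<close> is
  adjacent in it to a vertex outside \<open>W\<close>; as degrees are finite, \<open>V - W\<close> has the cardinality
  of \<open>V\<close>. Such a member exists as soon as \<open>W \<noteq> V\<close>: take the one containing an edge between \<open>W\<close>
  and \<open>V - W\<close>. This gives necessity.

  For sufficiency, let \<open>W\<close> correspond to the vertices of the copy of \<open>L\<close> and fix a solution for
  \<open>L\<close> on \<open>W\<close>. Each of its members has to be completed by a copy of the rest of \<open>F\<close> on \<open>V - W\<close>,
  and \<open>|V|\<close> further copies of \<open>F\<close> without edges inside \<open>W\<close> have to cover the remaining edges.
  All these embeddings are built simultaneously by transfinite recursion of length \<open>|V|\<close>: at
  each stage fewer than \<open>|V|\<close> values are fixed, so, degrees being finite, there is always room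
  to extend one embedding by a given vertex of its domain or range, or to cover a given edge
  by an embedding not yet started. The case \<open>W = {}\<close> gives the solution for \<open>L\<close> on \<open>W\<close>.
\<close>

section \<open>Constructions by transfinite recursion\<close>

lemma lepoll_iff_card_of_ordLeq: "A \<lesssim> B \<longleftrightarrow> ordLeq3 (card_of A) (card_of B)"
  by (simp add: lepoll_def card_of_ordLeq)

lemma lesspoll_iff_card_of_ordLess: "A \<prec> B \<longleftrightarrow> ordLess2 (card_of A) (card_of B)"
  unfolding lesspoll_def eqpoll_iff_card_of_ordIso lepoll_iff_card_of_ordLeq
  using not_ordLess_ordIso ordLeq_iff_ordLess_or_ordIso by blast

lemma UN_lepoll_infinite:
  assumes "infinite B" "A \<lesssim> B" "\<And>a. a \<in> A \<Longrightarrow> g a \<lesssim> B"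
  shows "(\<Union>a\<in>A. g a) \<lesssim> B"
  using assms card_of_UNION_ordLeq_infinite[of B A g]
  by (simp add: lepoll_iff_card_of_ordLeq)

lemma Un_lepoll_infinite: "infinite B \<Longrightarrow> A \<lesssim> B \<Longrightarrow> A' \<lesssim> B \<Longrightarrow> A \<union> A' \<lesssim> B"
  using UN_lepoll_infinite[of B "{A, A'}" id] finite_lepoll_infinite[of B "{A, A'}"] by auto

text \<open>Strictness needs no regularity of the cardinal: finitely many finite sets have a finite
  union, and an infinite family of finite sets has a union no larger than its index set.\<close>

lemma UN_finite_lesspoll:
  assumes K: "infinite K" and A: "A \<prec> K" and fin: "\<And>a. a \<in> A \<Longrightarrow> finite (g a)"
  shows "(\<Union>a\<in>A. g a) \<prec> K"
proof (cases "finite A")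
  case True
  with fin show ?thesis by (intro finite_lesspoll_infinite[OF K]) auto
next
  case False
  then have "(\<Union>a\<in>A. g a) \<lesssim> A"
    by (intro UN_lepoll_infinite) (auto intro: finite_lepoll_infinite fin)
  then show ?thesis using A by (rule lesspoll_trans1)
qed

text \<open>The choice principle behind every extension step: each element of \<open>S\<close>
  forbids only finitely many values, so fewer than \<open>|K|\<close> values are forbidden
  altogether.\<close>

lemma fresh_element:
  assumes "infinite K" "S \<prec> K" "K \<lesssim> X" "\<And>s. s \<in> S \<Longrightarrow> finite (g s)"
  obtains x where "x \<in> X" "\<And>s. s \<in> S \<Longrightarrow> x \<notin> g s"
proof -
  have "\<not> X \<subseteq> (\<Union>s\<in>S. g s)"
    using UN_finite_lesspoll[OF assms(1,2), of g] assms(3,4)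
    by (meson lepoll_trans lesspoll_def lesspoll_trans1 lesspoll_not_refl subset_imp_lepoll)
  then show ?thesis using that by blast
qed

text \<open>The requirements are well-ordered in the type of a cardinal and met one after the other,
  each by adding finitely many elements. Hence fewer than \<open>|K|\<close> elements are present at every
  stage, and finite character carries \<open>ok\<close> through limit stages.\<close>

lemma meet_requirements:
  fixes T :: "('s set \<Rightarrow> bool) set" and K :: "'k set"
  assumes K: "infinite K" and T: "T \<lesssim> K"
    and fin_char: "\<And>S. ok S \<longleftrightarrow> (\<forall>A. finite A \<longrightarrow> A \<subseteq> S \<longrightarrow> ok A)"
    and empty: "ok {}"
    and mono: "\<And>P S S'. P \<in> T \<Longrightarrow> P S \<Longrightarrow> S \<subseteq> S' \<Longrightarrow> P S'"
    and extend: "\<And>P S. P \<in> T \<Longrightarrow> ok S \<Longrightarrow> S \<prec> K \<Longrightarrow> \<exists>D. finite D \<and> ok (S \<union> D) \<and> P (S \<union> D)"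
  obtains S where "ok S" "\<And>P. P \<in> T \<Longrightarrow> P S"
proof -
  \<comment> \<open>A finite subset of the union of a nonempty chain already lies in one member, so
    finite character applies.\<close>
  have ok_Union: "ok (\<Union>C)" if C: "\<And>S. S \<in> C \<Longrightarrow> ok S" "subset.chain UNIV C" for C
  proof (cases "C = {}")
    case False
    show ?thesis
    proof (subst fin_char, intro allI impI)
      fix A assume "finite A" "A \<subseteq> \<Union>C"
      then obtain S where "S \<in> C" "A \<subseteq> S"
        using finite_subset_Union_chain[OF _ _ False C(2)] by blast
      then show "ok A" using C(1) fin_char \<open>finite A\<close> by blast
    qed
  qed (simp add: empty)
  define r where "r = card_of T"
  have wo: "wo_rel r" unfolding r_def wo_rel_def by (rule card_of_Well_order)
  have Fr: "Field r = T" unfolding r_def by (rule Field_card_of)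
  have Cr: "Card_order r" unfolding r_def by (rule card_of_Card_order)
  \<comment> \<open>\<open>D P\<close> is the finite set added to meet \<open>P\<close>. The
    recursion runs along \<open>r - Id\<close>, the strict part of the well-order;
    \<open>U P\<close> collects everything added before.\<close>
  define D where "D = wfrec (r - Id) (\<lambda>f P. SOME D. finite D \<and>
    ok ((\<Union>Q\<in>underS r P. f Q) \<union> D) \<and> P ((\<Union>Q\<in>underS r P. f Q) \<union> D))"
  define U where "U P = (\<Union>Q\<in>underS r P. D Q)" for P
  have wf: "wf (r - Id)" using wo wo_rel.WF by blast
  have D: "D P = (SOME D. finite D \<and> ok (U P \<union> D) \<and> P (U P \<union> D))" for P
  proof -
    \<comment> \<open>Only values at strict predecessors are consulted, where \<open>cut\<close>
      changes nothing.\<close>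
    have "(\<Union>Q\<in>underS r P. cut D (r - Id) P Q) = U P"
      by (auto simp: U_def underS_def cut_def)
    then show ?thesis
      using wfrec[OF wf, of "\<lambda>f P. SOME D. finite D \<and>
        ok ((\<Union>Q\<in>underS r P. f Q) \<union> D) \<and> P ((\<Union>Q\<in>underS r P. f Q) \<union> D)" P]
      by (simp add: D_def)
  qed
  have mono_U: "U P \<union> D P \<subseteq> U Q" if "P \<in> underS r Q" for P Q
  proof -
    have "underS r P \<subseteq> underS r Q"
      using that wo_rel.TRANS[OF wo] wo_rel.ANTISYM[OF wo]
      by (auto simp: underS_def dest: transD antisymD)
    then show ?thesis using that by (auto simp: U_def)
  qed
  have chain: "subset.chain UNIV ((\<lambda>P. U P \<union> D P) ` X)" if "X \<subseteq> T" for X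
  proof -
    have "U P \<union> D P \<subseteq> U Q \<union> D Q \<or> U Q \<union> D Q \<subseteq> U P \<union> D P" if "P \<in> T" "Q \<in> T" for P Q
    proof -
      have "P = Q \<or> P \<in> underS r Q \<or> Q \<in> underS r P"
        using that wo_rel.TOTALS[OF wo] by (auto simp: Fr underS_def)
      then show ?thesis using mono_U by blast
    qed
    then show ?thesis using that unfolding subset_chain_def by blast
  qed
  have step: "finite (D P) \<and> ok (U P \<union> D P) \<and> P (U P \<union> D P)" if "P \<in> T" for P
    using wf that
  proof (induction P rule: wf_induct_rule)
    case (less P)
    have IH: "finite (D Q)" "ok (U Q \<union> D Q)" if "Q \<in> underS r P" for Q
      using less.IH[of Q] that Fr by (auto simp: underS_def Field_def)
    have sub: "underS r P \<subseteq> T" using Fr by (auto simp: underS_def Field_def)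
    \<comment> \<open>As the union of the chain of earlier stages, \<open>U P\<close> falls under
      \<open>ok_Union\<close>; first, successor and limit stages are treated alike.\<close>
    have eq: "U P = \<Union>((\<lambda>P. U P \<union> D P) ` underS r P)"
    proof
      show "U P \<subseteq> \<Union>((\<lambda>P. U P \<union> D P) ` underS r P)"
        unfolding U_def[of P] by blast
    qed (use mono_U in blast)
    have "ok (U P)"
      unfolding eq by (rule ok_Union[OF _ chain[OF sub]]) (use IH in blast)
    \<comment> \<open>Since \<open>r\<close> is a cardinal order and not just a well-order, each
      proper initial segment is smaller than \<open>T\<close>, so fewer than \<open>|K|\<close>
      finite sets have been added so far.\<close>
    moreover have "underS r P \<prec> K"
      using card_of_underS[OF Cr, of P] less.prems Fr T
      by (metis lesspoll_iff_card_of_ordLess lesspoll_trans2 r_def)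
    then have "U P \<prec> K"
      unfolding U_def by (rule UN_finite_lesspoll[OF K]) (rule IH(1))
    ultimately show ?case
      using someI_ex[OF extend[OF less.prems]] unfolding D[of P] by blast
  qed
  have "ok (\<Union>P\<in>T. U P \<union> D P)"
    by (rule ok_Union[OF _ chain]) (use step in auto)
  moreover have "P (\<Union>P\<in>T. U P \<union> D P)" if "P \<in> T" for P
    by (rule mono[OF that, of "U P \<union> D P"]) (use step that in auto)
  ultimately show ?thesis using that by blast
qed

section \<open>Images of graphs\<close>

definition image_graph :: "('a \<Rightarrow> 'b) \<Rightarrow> 'a graph \<Rightarrow> 'b graph" where
  "image_graph f G = Graph (f ` verts G) (image f ` edges G)"

lemma verts_image_graph [simp]: "verts (image_graph f G) = f ` verts G"
  by (simp add: image_graph_def)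

lemma edges_image_graph: "edges (image_graph f G) = image f ` edges G"
  by (simp add: image_graph_def)

lemma simple_graph_edge: "simple_graph G \<Longrightarrow> {x, y} \<in> edges G \<Longrightarrow> x \<in> verts G \<and> y \<in> verts G \<and> x \<noteq> y"
  unfolding simple_graph_def by (fastforce simp: card_2_iff)

lemma simple_graph_edgeE:
  assumes "simple_graph G" "e \<in> edges G"
  obtains x y where "e = {x, y}" "x \<in> verts G" "y \<in> verts G" "x \<noteq> y"
  using assms unfolding simple_graph_def by (fastforce simp: card_2_iff)

section \<open>Packing locally finite graphs into a complete graph\<close>

text \<open>\<open>B i\<close> is the prescribed range of the embedding of \<open>\<Phi> i\<close>.
  Edges inside \<open>W\<close> are forbidden; every other edge is to be covered exactly once. The
  set \<open>V - W\<close>, common to all ranges, supplies fresh images, and \<open>many\<close>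
  supplies unstarted embeddings of full range, needed for edges that have one end in
  \<open>W\<close>.\<close>

locale edge_packing =
  fixes I :: "'i set" and \<Phi> :: "'i \<Rightarrow> 'a graph" and B :: "'i \<Rightarrow> 'v set" and V W :: "'v set"
  assumes inf_V: "infinite V" and W_sub: "W \<subseteq> V" and V_minus_W: "V \<lesssim> V - W"
    and I_le: "I \<lesssim> V"
    and simple: "\<And>i. i \<in> I \<Longrightarrow> simple_graph (\<Phi> i)"
    and loc_fin: "\<And>i x. i \<in> I \<Longrightarrow> finite {y. {x, y} \<in> edges (\<Phi> i)}"
    and verts_eq: "\<And>i. i \<in> I \<Longrightarrow> verts (\<Phi> i) \<approx> V"
    and B: "\<And>i. i \<in> I \<Longrightarrow> V - W \<subseteq> B i \<and> B i \<subseteq> V"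
    and many: "V \<lesssim> {i \<in> I. B i = V \<and> edges (\<Phi> i) \<noteq> {}}"
begin

text \<open>A triple \<open>(i, x, v)\<close> says that the partial embedding of \<open>\<Phi> i\<close> sends \<open>x\<close> to \<open>v\<close>.\<close>

definition covers :: "('i \<times> 'a \<times> 'v) set \<Rightarrow> 'i \<Rightarrow> 'v set \<Rightarrow> bool" where
  "covers S i e \<longleftrightarrow> (\<exists>x y v w. (i, x, v) \<in> S \<and> (i, y, w) \<in> S \<and> {x, y} \<in> edges (\<Phi> i) \<and> e = {v, w})"

text \<open>The equivalence \<open>x = y \<longleftrightarrow> v = w\<close> makes each partial
  embedding single-valued and injective at once.\<close>

definition admissible :: "('i \<times> 'a \<times> 'v) set \<Rightarrow> bool" where
  "admissible S \<longleftrightarrow>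
     (\<forall>i x v. (i, x, v) \<in> S \<longrightarrow> i \<in> I \<and> x \<in> verts (\<Phi> i) \<and> v \<in> B i) \<and>
     (\<forall>i x y v w. (i, x, v) \<in> S \<longrightarrow> (i, y, w) \<in> S \<longrightarrow> (x = y \<longleftrightarrow> v = w)) \<and>
     (\<forall>i e. covers S i e \<longrightarrow> \<not> e \<subseteq> W) \<and>
     (\<forall>i j e. covers S i e \<longrightarrow> covers S j e \<longrightarrow> i = j)"

lemma covers_mono: "covers S i e \<Longrightarrow> S \<subseteq> S' \<Longrightarrow> covers S' i e"
  unfolding covers_def by blast

lemma covers_finite:
  assumes "covers S i e"
  obtains A where "finite A" "A \<subseteq> S" "covers A i e"
proof -
  obtain x y v w where *: "(i, x, v) \<in> S" "(i, y, w) \<in> S" "{x, y} \<in> edges (\<Phi> i)" "e = {v, w}"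
    using assms unfolding covers_def by blast
  show ?thesis
    by (rule that[of "{(i, x, v), (i, y, w)}"]) (use * in \<open>auto simp: covers_def\<close>)
qed

lemma admissible_subset: "admissible S \<Longrightarrow> A \<subseteq> S \<Longrightarrow> admissible A"
  unfolding admissible_def using covers_mono by (smt (verit) subset_eq)

text \<open>A violation of any clause of \<open>admissible\<close> is witnessed by at most four
  triples, two for each covered edge.\<close>

lemma admissible_finite_character:
  "admissible S \<longleftrightarrow> (\<forall>A. finite A \<longrightarrow> A \<subseteq> S \<longrightarrow> admissible A)"
proof
  assume fin: "\<forall>A. finite A \<longrightarrow> A \<subseteq> S \<longrightarrow> admissible A"
  have "i \<in> I \<and> x \<in> verts (\<Phi> i) \<and> v \<in> B i" if "(i, x, v) \<in> S" for i x v
    using fin[rule_format, of "{(i, x, v)}"] that unfolding admissible_def by simp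
  moreover have "x = y \<longleftrightarrow> v = w" if "(i, x, v) \<in> S" "(i, y, w) \<in> S" for i x y v w
    using fin[rule_format, of "{(i, x, v), (i, y, w)}"] that unfolding admissible_def by blast
  moreover have "\<not> e \<subseteq> W" if "covers S i e" for i e
    using fin that covers_finite[OF that] unfolding admissible_def by metis
  moreover have "i = j" if S: "covers S i e" "covers S j e" for i j e
  proof -
    obtain A A' where "finite A" "A \<subseteq> S" "covers A i e" "finite A'" "A' \<subseteq> S" "covers A' j e"
      using covers_finite S by metis
    then have "finite (A \<union> A')" "A \<union> A' \<subseteq> S" "covers (A \<union> A') i e" "covers (A \<union> A') j e"
      using covers_mono[of A i e "A \<union> A'"] covers_mono[of A' j e "A \<union> A'"] by auto
    then show ?thesis using fin unfolding admissible_def by metis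
  qed
  ultimately show "admissible S" unfolding admissible_def by auto
qed (use admissible_subset in blast)

lemma covers_insert:
  assumes "i \<in> I" "covers (insert (i, x, v) S) j e"
  shows "covers S j e \<or> j = i \<and> (\<exists>y w. (i, y, w) \<in> S \<and> {x, y} \<in> edges (\<Phi> i) \<and> e = {v, w})"
proof -
  obtain y z u w where *: "(j, y, u) \<in> insert (i, x, v) S" "(j, z, w) \<in> insert (i, x, v) S"
     "{y, z} \<in> edges (\<Phi> j)" "e = {u, w}"
    using assms(2) unfolding covers_def by blast
  \<comment> \<open>As there are no loops, the new triple can supply only one end of a covered
    edge.\<close>
  have "y \<noteq> z" if "j = i" using simple_graph_edge[OF simple[OF assms(1)]] *(3) that by blast
  then consider "(j, y, u) \<in> S" "(j, z, w) \<in> S"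
    | "j = i" "y = x" "u = v" "(i, z, w) \<in> S" | "j = i" "z = x" "w = v" "(i, y, u) \<in> S"
    using *(1,2) by blast
  then show ?thesis
  proof cases
    case 1
    with * show ?thesis unfolding covers_def by blast
  next
    case 2
    with * show ?thesis by blast
  next
    case 3
    with * have "{x, y} \<in> edges (\<Phi> i)" "e = {v, u}" by (simp_all add: insert_commute)
    with 3 show ?thesis by blast
  qed
qed

text \<open>All newly covered edges belong to the single index \<open>i\<close>, so they cannot
  conflict with one another; they only have to avoid \<open>W\<close> and the edges covered
  before.\<close>

lemma admissible_insert:
  assumes S: "admissible S" and "i \<in> I" "x \<in> verts (\<Phi> i)" "v \<in> B i"
    and x: "\<And>w. (i, x, w) \<notin> S" and v: "\<And>y. (i, y, v) \<notin> S"
    and new: "\<And>y w. (i, y, w) \<in> S \<Longrightarrow> {x, y} \<in> edges (\<Phi> i) \<Longrightarrow>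
      \<not> {v, w} \<subseteq> W \<and> (\<forall>j. \<not> covers S j {v, w})"
  shows "admissible (insert (i, x, v) S)"
proof -
  have S': "\<And>j y u. (j, y, u) \<in> S \<Longrightarrow> j \<in> I \<and> y \<in> verts (\<Phi> j) \<and> u \<in> B j"
    "\<And>j y z u w. (j, y, u) \<in> S \<Longrightarrow> (j, z, w) \<in> S \<Longrightarrow> (y = z \<longleftrightarrow> u = w)"
    "\<And>j e. covers S j e \<Longrightarrow> \<not> e \<subseteq> W"
    "\<And>j k e. covers S j e \<Longrightarrow> covers S k e \<Longrightarrow> j = k"
    using S unfolding admissible_def by simp_all
  have cov: "covers S j e \<or> j = i \<and> \<not> e \<subseteq> W \<and> (\<forall>k. \<not> covers S k e)"
    if "covers (insert (i, x, v) S) j e" for j e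
    using covers_insert[OF \<open>i \<in> I\<close> that] new by auto
  have "j \<in> I \<and> y \<in> verts (\<Phi> j) \<and> u \<in> B j" if "(j, y, u) \<in> insert (i, x, v) S" for j y u
    using that assms(2-4) S'(1) by auto
  moreover have "y = z \<longleftrightarrow> u = w"
    if "(j, y, u) \<in> insert (i, x, v) S" "(j, z, w) \<in> insert (i, x, v) S" for j y z u w
    using that x v S'(2)[of j y u z w] by auto
  moreover have "\<not> e \<subseteq> W" if "covers (insert (i, x, v) S) j e" for j e
    using cov[OF that] S'(3) by blast
  moreover have "j = k"
    if "covers (insert (i, x, v) S) j e" "covers (insert (i, x, v) S) k e" for j k e
    using cov[OF that(1)] cov[OF that(2)] S'(4) by blast
  ultimately show ?thesis unfolding admissible_def by simp
qed

section \<open>Extending a partial packing\<close>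

text \<open>Send \<open>x\<close> to a vertex \<open>v\<close> outside \<open>W\<close> that is not
  yet the image of anything. Every new edge contains \<open>v\<close>, hence is not inside
  \<open>W\<close> and was not covered.\<close>

lemma extend_domain:
  assumes S: "admissible S" "S \<prec> V" and i: "i \<in> I" and x: "x \<in> verts (\<Phi> i)"
  shows "\<exists>D. finite D \<and> admissible (S \<union> D) \<and> (\<exists>v. (i, x, v) \<in> S \<union> D)"
proof (cases "\<exists>v. (i, x, v) \<in> S")
  case True
  then show ?thesis using S by (intro exI[of _ "{}"]) auto
next
  case False
  obtain v where v: "v \<in> V - W" and "\<And>s. s \<in> S \<Longrightarrow> v \<notin> {snd (snd s)}"
    using fresh_element[OF inf_V S(2) V_minus_W, of "\<lambda>s. {snd (snd s)}"] by auto
  then have fresh: "(j, y, v) \<notin> S" for j y by force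
  have "admissible (insert (i, x, v) S)"
  proof (rule admissible_insert[OF S(1) i x])
    show "v \<in> B i" using B[OF i] v by blast
    have "\<not> covers S j {v, w}" for j w
      using fresh unfolding covers_def by (metis doubleton_eq_iff)
    with v show "\<not> {v, w} \<subseteq> W \<and> (\<forall>j. \<not> covers S j {v, w})" for w by blast
  qed (use False fresh in auto)
  then show ?thesis by (intro exI[of _ "{(i, x, v)}"]) auto
qed

lemma extend_range:
  assumes S: "admissible S" "S \<prec> V" and i: "i \<in> I" and v: "v \<in> B i"
  shows "\<exists>D. finite D \<and> admissible (S \<union> D) \<and> (\<exists>x. (i, x, v) \<in> S \<union> D)"
proof (cases "\<exists>x. (i, x, v) \<in> S")
  case True
  then show ?thesis using S by (intro exI[of _ "{}"]) auto
next
  case False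
  have "V \<lesssim> verts (\<Phi> i)" using verts_eq[OF i] by (simp add: eqpoll_imp_lepoll eqpoll_sym)
  then obtain x where x: "x \<in> verts (\<Phi> i)"
    and "\<And>s. s \<in> S \<Longrightarrow> x \<notin> insert (fst (snd s)) {y. {fst (snd s), y} \<in> edges (\<Phi> i)}"
    using fresh_element[OF inf_V S(2), of "verts (\<Phi> i)"
      "\<lambda>s. insert (fst (snd s)) {y. {fst (snd s), y} \<in> edges (\<Phi> i)}"] loc_fin[OF i] by auto
  then have fresh: "(i, x, w) \<notin> S" "(i, y, w) \<in> S \<Longrightarrow> {x, y} \<notin> edges (\<Phi> i)" for y w
    by (force simp: insert_commute)+
  have "admissible (insert (i, x, v) S)"
    by (rule admissible_insert[OF S(1) i x v]) (use False fresh in auto)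
  then show ?thesis by (intro exI[of _ "{(i, x, v)}"]) auto
qed

lemma extend_edge:
  assumes S: "admissible S" "S \<prec> V" and e: "e \<subseteq> V" "card e = 2" "\<not> e \<subseteq> W"
  shows "\<exists>D. finite D \<and> admissible (S \<union> D) \<and> (\<exists>i. covers (S \<union> D) i e)"
proof (cases "\<exists>i. covers S i e")
  case True
  then show ?thesis using S by (intro exI[of _ "{}"]) auto
next
  case False
  obtain a b where ab: "e = {a, b}" "a \<noteq> b" using e(2) by (auto simp: card_2_iff)
  obtain i where "i \<in> {i \<in> I. B i = V \<and> edges (\<Phi> i) \<noteq> {}}" and "\<And>s. s \<in> S \<Longrightarrow> i \<notin> {fst s}"
    by (rule fresh_element[OF inf_V S(2) many, of "\<lambda>s. {fst s}"]) blast+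
  then have i: "i \<in> I" "B i = V" "edges (\<Phi> i) \<noteq> {}" and fresh: "(i, x, v) \<notin> S" for x v
    by force+
  obtain x y where xy: "{x, y} \<in> edges (\<Phi> i)" "x \<in> verts (\<Phi> i)" "y \<in> verts (\<Phi> i)" "x \<noteq> y"
    using i(3) simple_graph_edgeE[OF simple[OF i(1)]] by (metis ex_in_conv)
  \<comment> \<open>In an embedding not yet started, placing \<open>y\<close> alone covers nothing;
    placing its neighbour \<open>x\<close> then covers exactly \<open>e\<close>.\<close>
  have 1: "admissible (insert (i, y, b) S)"
    by (rule admissible_insert[OF S(1) i(1) xy(3)]) (use fresh e ab i in auto)
  have "\<not> covers (insert (i, y, b) S) j {a, b}" for j
    using covers_insert[OF i(1), of y b S j e] fresh False ab by blast
  then have "admissible (insert (i, x, a) (insert (i, y, b) S))"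
    by (intro admissible_insert[OF 1 i(1) xy(2)]) (use fresh e ab i xy in auto)
  moreover have "covers (insert (i, x, a) (insert (i, y, b) S)) i e"
    using xy ab unfolding covers_def by blast
  ultimately show ?thesis
    by (intro exI[of _ "{(i, x, a), (i, y, b)}"]) auto
qed

section \<open>Existence of the packing\<close>

lemma packing_exists:
  obtains \<phi> where
    "\<And>i. i \<in> I \<Longrightarrow> bij_betw (\<phi> i) (verts (\<Phi> i)) (B i)"
    "\<And>e. e \<subseteq> V \<Longrightarrow> card e = 2 \<Longrightarrow> \<not> e \<subseteq> W \<Longrightarrow> \<exists>!i. i \<in> I \<and> e \<in> edges (image_graph (\<phi> i) (\<Phi> i))"
    "\<And>i e. i \<in> I \<Longrightarrow> e \<in> edges (image_graph (\<phi> i) (\<Phi> i)) \<Longrightarrow> \<not> e \<subseteq> W"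
proof -
  \<comment> \<open>The requirements: every edge not inside \<open>W\<close> is covered, every
    embedding is total, and every embedding is onto its \<open>B i\<close>. Each family has at most
    \<open>|V|\<close> members because \<open>|V|\<close> times \<open>|V|\<close> is
    \<open>|V|\<close>.\<close>
  define edge_reqs where "edge_reqs = (\<lambda>e S. \<exists>i. covers S i e) ` {e. e \<subseteq> V \<and> card e = 2 \<and> \<not> e \<subseteq> W}"
  define dom_reqs where "dom_reqs = (\<Union>i\<in>I. (\<lambda>x (S :: ('i \<times> 'a \<times> 'v) set). \<exists>v. (i, x, v) \<in> S) ` verts (\<Phi> i))"
  define ran_reqs where "ran_reqs = (\<Union>i\<in>I. (\<lambda>v (S :: ('i \<times> 'a \<times> 'v) set). \<exists>x. (i, x, v) \<in> S) ` B i)"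
  have "{e. e \<subseteq> V \<and> card e = 2 \<and> \<not> e \<subseteq> W} \<subseteq> (\<Union>a\<in>V. (\<lambda>b. {a, b}) ` V)"
    by (auto simp: card_2_iff)
  moreover have "(\<Union>a\<in>V. (\<lambda>b. {a, b}) ` V) \<lesssim> V"
    by (rule UN_lepoll_infinite[OF inf_V]) (auto intro: image_lepoll)
  ultimately have "edge_reqs \<lesssim> V"
    unfolding edge_reqs_def by (meson image_lepoll lepoll_trans subset_imp_lepoll)
  moreover have "dom_reqs \<lesssim> V"
    unfolding dom_reqs_def
    by (rule UN_lepoll_infinite[OF inf_V I_le])
      (meson image_lepoll lepoll_trans2 verts_eq)
  moreover have "ran_reqs \<lesssim> V"
    unfolding ran_reqs_def
    by (rule UN_lepoll_infinite[OF inf_V I_le])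
      (meson B image_lepoll lepoll_trans subset_imp_lepoll)
  ultimately have "edge_reqs \<union> dom_reqs \<union> ran_reqs \<lesssim> V"
    by (intro Un_lepoll_infinite inf_V)
  then obtain S where S: "admissible S"
    and reqs: "\<And>P. P \<in> edge_reqs \<union> dom_reqs \<union> ran_reqs \<Longrightarrow> P S"
  proof (rule meet_requirements[OF inf_V _ admissible_finite_character])
    show "admissible {}" by (simp add: admissible_def covers_def)
    show "P S'" if "P \<in> edge_reqs \<union> dom_reqs \<union> ran_reqs" "P S" "S \<subseteq> S'" for P S S'
      using that covers_mono unfolding edge_reqs_def dom_reqs_def ran_reqs_def by blast
    show "\<exists>D. finite D \<and> admissible (S \<union> D) \<and> P (S \<union> D)"
      if "P \<in> edge_reqs \<union> dom_reqs \<union> ran_reqs" "admissible S" "S \<prec> V" for P S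
      using that extend_edge extend_domain extend_range
      unfolding edge_reqs_def dom_reqs_def ran_reqs_def by auto
  qed blast
  \<comment> \<open>The value is unique by admissibility and exists by
    \<open>dom_reqs\<close>.\<close>
  define \<phi> where "\<phi> i x = (THE v. (i, x, v) \<in> S)" for i x
  have dom: "\<exists>v. (i, x, v) \<in> S" if "i \<in> I" "x \<in> verts (\<Phi> i)" for i x
    using reqs[of "\<lambda>S. \<exists>v. (i, x, v) \<in> S"] that unfolding dom_reqs_def by blast
  have ran: "\<exists>x. (i, x, v) \<in> S" if "i \<in> I" "v \<in> B i" for i v
    using reqs[of "\<lambda>S. \<exists>x. (i, x, v) \<in> S"] that unfolding ran_reqs_def by blast
  have cov: "\<exists>i. covers S i e" if "e \<subseteq> V" "card e = 2" "\<not> e \<subseteq> W" for e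
    using reqs[of "\<lambda>S. \<exists>i. covers S i e"] that unfolding edge_reqs_def by blast
  have typed: "i \<in> I \<and> x \<in> verts (\<Phi> i) \<and> v \<in> B i" if "(i, x, v) \<in> S" for i x v
    using S that unfolding admissible_def by blast
  have inj: "x = y \<longleftrightarrow> v = w" if "(i, x, v) \<in> S" "(i, y, w) \<in> S" for i x y v w
    using S that unfolding admissible_def by blast
  have \<phi>_eq: "\<phi> i x = v" if "(i, x, v) \<in> S" for i x v
    unfolding \<phi>_def using that inj by blast
  have \<phi>_in: "(i, x, \<phi> i x) \<in> S" if "i \<in> I" "x \<in> verts (\<Phi> i)" for i x
    using dom[OF that] \<phi>_eq by blast
  have covers_iff: "e \<in> edges (image_graph (\<phi> i) (\<Phi> i)) \<longleftrightarrow> covers S i e" if i: "i \<in> I" for i e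
  proof
    assume "e \<in> edges (image_graph (\<phi> i) (\<Phi> i))"
    then obtain d where "d \<in> edges (\<Phi> i)" "e = \<phi> i ` d" by (auto simp: image_graph_def)
    moreover then obtain x y where "d = {x, y}" "x \<in> verts (\<Phi> i)" "y \<in> verts (\<Phi> i)"
      using simple_graph_edgeE[OF simple[OF i]] by metis
    ultimately show "covers S i e" using \<phi>_in[OF i] unfolding covers_def
      by (metis image_empty image_insert)
  next
    assume "covers S i e"
    then obtain x y v w where "(i, x, v) \<in> S" "(i, y, w) \<in> S" "{x, y} \<in> edges (\<Phi> i)" "e = {v, w}"
      unfolding covers_def by blast
    moreover then have "e = \<phi> i ` {x, y}" using \<phi>_eq by auto
    ultimately show "e \<in> edges (image_graph (\<phi> i) (\<Phi> i))" unfolding edges_image_graph by blast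
  qed
  show ?thesis
  proof (rule that)
    show "bij_betw (\<phi> i) (verts (\<Phi> i)) (B i)" if i: "i \<in> I" for i
    proof (rule bij_betw_imageI)
      show "inj_on (\<phi> i) (verts (\<Phi> i))"
        using \<phi>_in[OF i] inj by (metis inj_onI)
      show "\<phi> i ` verts (\<Phi> i) = B i"
      proof (intro equalityI subsetI)
        show "v \<in> B i" if "v \<in> \<phi> i ` verts (\<Phi> i)" for v
          using that \<phi>_in[OF i] typed by blast
        show "v \<in> \<phi> i ` verts (\<Phi> i)" if "v \<in> B i" for v
          using ran[OF i that] typed \<phi>_eq by (metis image_eqI)
      qed
    qed
    show "\<not> e \<subseteq> W" if "i \<in> I" "e \<in> edges (image_graph (\<phi> i) (\<Phi> i))" for i e
      using that covers_iff S unfolding admissible_def by blast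
    show "\<exists>!i. i \<in> I \<and> e \<in> edges (image_graph (\<phi> i) (\<Phi> i))"
      if e: "e \<subseteq> V" "card e = 2" "\<not> e \<subseteq> W" for e
    proof -
      obtain i where i: "covers S i e" using cov[OF e] by blast
      then have "i \<in> I" using typed unfolding covers_def by blast
      moreover have "j = i" if "covers S j e" for j
        using that i S unfolding admissible_def by blast
      ultimately show ?thesis using i covers_iff by blast
    qed
  qed
qed

end

section \<open>Regular graphs and isomorphisms\<close>

lemma regular_iff_card_neighbours:
  assumes G: "simple_graph G"
  shows "regular k G \<longleftrightarrow> (\<forall>x\<in>verts G. card {y. {x, y} \<in> edges G} = k)"
proof -
  have bij: "bij_betw (\<lambda>y. {x, y}) {y. {x, y} \<in> edges G} {e \<in> edges G. x \<in> e}" for x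
  proof (rule bij_betw_imageI)
    show "inj_on (\<lambda>y. {x, y}) {y. {x, y} \<in> edges G}"
      by (auto simp: inj_on_def doubleton_eq_iff)
    show "(\<lambda>y. {x, y}) ` {y. {x, y} \<in> edges G} = {e \<in> edges G. x \<in> e}"
    proof (intro equalityI subsetI)
      fix e assume e: "e \<in> {e \<in> edges G. x \<in> e}"
      then obtain u v where "e = {u, v}" using simple_graph_edgeE[OF G] by blast
      then show "e \<in> (\<lambda>y. {x, y}) ` {y. {x, y} \<in> edges G}"
        using e by (auto simp: insert_commute)
    qed auto
  qed
  then have "card {e \<in> edges G. x \<in> e} = card {y. {x, y} \<in> edges G}" for x
    using bij_betw_same_card[OF bij[of x]] by simp
  then show ?thesis unfolding regular_def by simp
qed

lemma finite_neighbours: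
  assumes "simple_graph G" "regular k G" "k > 0"
  shows "finite {y. {x, y} \<in> edges G}"
proof (cases "x \<in> verts G")
  case True
  then have "card {y. {x, y} \<in> edges G} = k"
    using assms(1,2) regular_iff_card_neighbours by blast
  \<comment> \<open>Positivity of \<open>k\<close> rules out the value 0 that \<open>card\<close>
    takes on infinite sets.\<close>
  then show ?thesis using assms(3) by (intro card_ge_0_finite) simp
next
  case False
  then have "{y. {x, y} \<in> edges G} = {}" using simple_graph_edge[OF assms(1)] by blast
  then show ?thesis by simp
qed

text \<open>A finite set has no proper subset of its own size, so \<open>H\<close> uses up all edges
  of \<open>G\<close> at its vertices: no edge of \<open>G\<close> leaves a \<open>k\<close>-regular
  subgraph.\<close>

lemma neighbour_sets_eq:
  assumes H: "simple_graph H" "regular k H" and G: "simple_graph G" "regular k G" and "k > 0"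
    and sub: "edges H \<subseteq> edges G" and x: "x \<in> verts H" "x \<in> verts G"
  shows "{y. {x, y} \<in> edges H} = {y. {x, y} \<in> edges G}"
proof (rule card_subset_eq)
  show "finite {y. {x, y} \<in> edges G}" by (rule finite_neighbours[OF G \<open>k > 0\<close>])
  show "card {y. {x, y} \<in> edges H} = card {y. {x, y} \<in> edges G}"
    using H(2) G(2) x
    unfolding regular_iff_card_neighbours[OF H(1)] regular_iff_card_neighbours[OF G(1)]
    by metis
qed (use sub in blast)

lemma ex_neighbour:
  assumes "simple_graph G" "regular k G" "k > 0" "x \<in> verts G"
  obtains y where "{x, y} \<in> edges G"
proof -
  have "card {y. {x, y} \<in> edges G} = k"
    using assms(1,2,4) regular_iff_card_neighbours by blast
  then have "{y. {x, y} \<in> edges G} \<noteq> {}" using assms(3) by (metis card.empty less_irrefl)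
  then show ?thesis using that by blast
qed

section \<open>Isomorphisms as images\<close>

lemma isomorphic_sym: "isomorphic G H \<Longrightarrow> isomorphic H G"
  unfolding isomorphic_def
proof (elim exE conjE)
  fix f
  assume f: "bij_betw f (verts G) (verts H)"
    and e: "\<forall>u\<in>verts G. \<forall>v\<in>verts G. {u, v} \<in> edges G \<longleftrightarrow> {f u, f v} \<in> edges H"
  let ?g = "inv_into (verts G) f"
  have "?g u \<in> verts G" "f (?g u) = u" if "u \<in> verts H" for u
    using f that by (auto simp: bij_betw_def inv_into_into f_inv_into_f)
  then have "\<forall>u\<in>verts H. \<forall>v\<in>verts H. {u, v} \<in> edges H \<longleftrightarrow> {?g u, ?g v} \<in> edges G"
    using e by metis
  with bij_betw_inv_into[OF f]
  show "\<exists>g. bij_betw g (verts H) (verts G) \<and>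
      (\<forall>u\<in>verts H. \<forall>v\<in>verts H. {u, v} \<in> edges H \<longleftrightarrow> {g u, g v} \<in> edges G)" by blast
qed

lemma isomorphic_trans: "isomorphic G H \<Longrightarrow> isomorphic H J \<Longrightarrow> isomorphic G J"
  unfolding isomorphic_def
proof (elim exE conjE)
  fix f g
  assume f: "bij_betw f (verts G) (verts H)"
    "\<forall>u\<in>verts G. \<forall>v\<in>verts G. {u, v} \<in> edges G \<longleftrightarrow> {f u, f v} \<in> edges H"
    and g: "bij_betw g (verts H) (verts J)"
    "\<forall>u\<in>verts H. \<forall>v\<in>verts H. {u, v} \<in> edges H \<longleftrightarrow> {g u, g v} \<in> edges J"
  have "f u \<in> verts H" if "u \<in> verts G" for u using f(1) that by (auto simp: bij_betw_def)
  then show "\<exists>h. bij_betw h (verts G) (verts J) \<and>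
      (\<forall>u\<in>verts G. \<forall>v\<in>verts G. {u, v} \<in> edges G \<longleftrightarrow> {h u, h v} \<in> edges J)"
    using f g bij_betw_trans[OF f(1) g(1)] by (intro exI[of _ "g \<circ> f"]) auto
qed

lemma simple_graph_image_graph:
  assumes "simple_graph G" "inj_on f (verts G)"
  shows "simple_graph (image_graph f G)"
  unfolding simple_graph_def edges_image_graph verts_image_graph
proof (intro ballI)
  fix d assume "d \<in> image f ` edges G"
  then obtain e where "d = f ` e" "e \<subseteq> verts G" "card e = 2"
    using assms(1) unfolding simple_graph_def by blast
  moreover then have "card (f ` e) = card e" using assms(2) by (metis card_image inj_on_subset)
  ultimately show "d \<subseteq> f ` verts G \<and> card d = 2" by (simp add: image_mono)
qed

lemma image_graph_edge_iff:
  assumes "simple_graph G" "inj_on f (verts G)" "x \<in> verts G" "y \<in> verts G"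
  shows "{f x, f y} \<in> edges (image_graph f G) \<longleftrightarrow> {x, y} \<in> edges G"
proof
  assume "{f x, f y} \<in> edges (image_graph f G)"
  then obtain d where d: "d \<in> edges G" "f ` {x, y} = f ` d" by (auto simp: image_graph_def)
  moreover have "d \<subseteq> verts G" using d(1) assms(1) by (auto simp: simple_graph_def)
  ultimately show "{x, y} \<in> edges G"
    using assms inj_on_image_eq_iff[of f "verts G" "{x, y}" d] by auto
next
  assume "{x, y} \<in> edges G"
  then have "f ` {x, y} \<in> edges (image_graph f G)" unfolding edges_image_graph by blast
  then show "{f x, f y} \<in> edges (image_graph f G)" by simp
qed

lemma isomorphic_image_graph:
  assumes "simple_graph G" "inj_on f (verts G)"
  shows "isomorphic G (image_graph f G)"
proof -
  have "bij_betw f (verts G) (verts (image_graph f G))"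
    using assms(2) by (simp add: bij_betw_def)
  moreover have "\<forall>u\<in>verts G. \<forall>v\<in>verts G. {u, v} \<in> edges G \<longleftrightarrow> {f u, f v} \<in> edges (image_graph f G)"
    using image_graph_edge_iff[OF assms] by simp
  ultimately show ?thesis unfolding isomorphic_def by blast
qed

text \<open>Turns the adjacency condition into an equality of graphs. Simplicity enters because that
  condition speaks only of edges of the form \<open>{u, v}\<close> between vertices.\<close>

lemma isomorphicE:
  assumes iso: "isomorphic G H" and G: "simple_graph G" and H: "simple_graph H"
  obtains f where "inj_on f (verts G)" "H = image_graph f G"
proof -
  obtain f where f: "bij_betw f (verts G) (verts H)"
    and e: "\<And>u v. u \<in> verts G \<Longrightarrow> v \<in> verts G \<Longrightarrow> {u, v} \<in> edges G \<longleftrightarrow> {f u, f v} \<in> edges H"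
    using iso unfolding isomorphic_def by blast
  have "edges H = image f ` edges G"
  proof (intro equalityI subsetI)
    fix d assume d: "d \<in> edges H"
    then obtain a b where ab: "d = {a, b}" "a \<in> verts H" "b \<in> verts H"
      using simple_graph_edgeE[OF H] by metis
    then obtain u v where "u \<in> verts G" "v \<in> verts G" "a = f u" "b = f v"
      using f by (metis bij_betw_imp_surj_on imageE)
    then show "d \<in> image f ` edges G"
      using d ab e by (intro image_eqI[of _ _ "{u, v}"]) auto
  next
    fix d assume "d \<in> image f ` edges G"
    then obtain c where c: "c \<in> edges G" "d = f ` c" by blast
    then obtain u v where "c = {u, v}" "u \<in> verts G" "v \<in> verts G"
      using simple_graph_edgeE[OF G] by metis
    then show "d \<in> edges H" using c e by auto
  qed
  then have "H = image_graph f G"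
    using f by (cases H) (auto simp: image_graph_def bij_betw_def)
  then show ?thesis using that f by (auto simp: bij_betw_def)
qed

lemma regular_isomorphic:
  assumes "isomorphic G H" and G: "simple_graph G" and H: "simple_graph H" and "regular k G"
  shows "regular k H"
proof -
  obtain f where f: "inj_on f (verts G)" and eq: "H = image_graph f G"
    using assms isomorphicE by blast
  have "{y. {f x, y} \<in> edges H} = f ` {y. {x, y} \<in> edges G}" if x: "x \<in> verts G" for x
  proof (intro equalityI subsetI)
    fix z assume "z \<in> {y. {f x, y} \<in> edges H}"
    moreover then have "z \<in> verts H" using simple_graph_edge[OF H] by blast
    then obtain y where "z = f y" "y \<in> verts G" unfolding eq by auto
    ultimately show "z \<in> f ` {y. {x, y} \<in> edges G}"
      using image_graph_edge_iff[OF G f x] by (auto simp: eq)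
  next
    fix z assume "z \<in> f ` {y. {x, y} \<in> edges G}"
    then show "z \<in> {y. {f x, y} \<in> edges H}"
      using image_graph_edge_iff[OF G f x] simple_graph_edge[OF G] by (auto simp: eq)
  qed
  moreover have "inj_on f {y. {x, y} \<in> edges G}" for x
    using f by (rule inj_on_subset) (use simple_graph_edge[OF G] in blast)
  ultimately have "card {y. {f x, y} \<in> edges H} = k" if "x \<in> verts G" for x
    using assms(4) that by (simp add: regular_iff_card_neighbours[OF G] card_image)
  then show ?thesis
    unfolding regular_iff_card_neighbours[OF H] by (simp add: eq)
qed

section \<open>Solutions and subsystems\<close>

lemma spanning_subgraph_complete_graph_iff:
  "spanning_subgraph G (complete_graph V) \<longleftrightarrow> simple_graph G \<and> verts G = V"
proof -
  have "edges G \<subseteq> edges (complete_graph (verts G))" if "simple_graph G"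
    using that by (auto simp: complete_graph_def simple_graph_def)
  moreover have "verts (complete_graph V) = V" by (simp add: complete_graph_def)
  ultimately show ?thesis unfolding spanning_subgraph_def subgraph_def by blast
qed

lemma OP_solution_alt:
  "OP_solution F V \<FF> \<longleftrightarrow> V \<approx> verts F \<and>
     (\<forall>G\<in>\<FF>. simple_graph G \<and> verts G = V \<and> isomorphic G F) \<and>
     (\<forall>e. e \<subseteq> V \<longrightarrow> card e = 2 \<longrightarrow> (\<exists>!G. G \<in> \<FF> \<and> e \<in> edges G))"
  unfolding OP_solution_def spanning_subgraph_complete_graph_iff
  by (simp add: complete_graph_def imp_conjL)

lemma OP_solution_edge:
  assumes "OP_solution F V \<FF>" "x \<in> V" "y \<in> V" "x \<noteq> y"
  shows "\<exists>!G. G \<in> \<FF> \<and> {x, y} \<in> edges G"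
proof -
  have "{x, y} \<subseteq> V" "card {x, y} = 2" using assms by auto
  then show ?thesis using assms(1) unfolding OP_solution_alt by presburger
qed

text \<open>A unique index with \<open>e \<in> edges (G i)\<close> gives a unique member containing
  \<open>e\<close>, so injectivity of \<open>G\<close> need not be checked separately.\<close>

lemma OP_solution_indexed:
  assumes "V \<approx> verts F"
    and "\<And>i. i \<in> I \<Longrightarrow> simple_graph (G i) \<and> verts (G i) = V \<and> isomorphic F (G i)"
    and "\<And>e. e \<subseteq> V \<Longrightarrow> card e = 2 \<Longrightarrow> \<exists>!i. i \<in> I \<and> e \<in> edges (G i)"
  shows "OP_solution F V (G ` I)"
proof -
  have "\<exists>!H. H \<in> G ` I \<and> e \<in> edges H" if "e \<subseteq> V" "card e = 2" for e
    using assms(3)[OF that] by blast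
  moreover have "simple_graph H \<and> verts H = V \<and> isomorphic H F" if "H \<in> G ` I" for H
    using that assms(2) isomorphic_sym by blast
  ultimately show ?thesis using assms(1) unfolding OP_solution_alt by simp
qed

lemma OP_solution_member_regular:
  assumes "OP_solution F V \<FF>" "G \<in> \<FF>" "simple_graph F" "regular k F"
  shows "simple_graph G" "verts G = V" "isomorphic F G" "regular k G"
proof -
  show G: "simple_graph G" "verts G = V" and "isomorphic F G"
    using assms(1,2) isomorphic_sym unfolding OP_solution_alt by auto
  then show "regular k G" using regular_isomorphic assms(3,4) by blast
qed

lemma OP_solution_exists:
  assumes F: "simple_graph F" "regular k F" "k > 0" "infinite (verts F)" and V: "V \<approx> verts F"
  shows "\<exists>\<FF>. OP_solution F V \<FF>"
proof -
  have inf: "infinite V" using V F(4) eqpoll_finite_iff by blast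
  obtain x where "x \<in> verts F" using F(4) by fastforce
  then have ne: "edges F \<noteq> {}" using ex_neighbour[OF F(1-3)] by (metis empty_iff)
  \<comment> \<open>\<open>|V|\<close> copies of \<open>F\<close>, all with full range and with no
    forbidden edges.\<close>
  interpret edge_packing V "\<lambda>_. F" "\<lambda>_. V" V "{}"
  proof
    show "finite {y. {x, y} \<in> edges F}" for x by (rule finite_neighbours[OF F(1-3)])
    show "verts F \<approx> V" using V by (rule eqpoll_sym)
  qed (use inf F(1) ne in auto)
  obtain \<phi> where \<phi>: "\<And>i. i \<in> V \<Longrightarrow> bij_betw (\<phi> i) (verts F) V"
    "\<And>e. e \<subseteq> V \<Longrightarrow> card e = 2 \<Longrightarrow> \<not> e \<subseteq> {} \<Longrightarrow> \<exists>!i. i \<in> V \<and> e \<in> edges (image_graph (\<phi> i) F)"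
    using packing_exists by metis
  have "OP_solution F V ((\<lambda>i. image_graph (\<phi> i) F) ` V)"
  proof (rule OP_solution_indexed[OF V])
    fix i assume "i \<in> V"
    then have "inj_on (\<phi> i) (verts F)" "\<phi> i ` verts F = V" using \<phi>(1) by (auto simp: bij_betw_def)
    then show "simple_graph (image_graph (\<phi> i) F) \<and> verts (image_graph (\<phi> i) F) = V \<and>
        isomorphic F (image_graph (\<phi> i) F)"
      using simple_graph_image_graph isomorphic_image_graph F(1) by auto
  qed (rule \<phi>(2), auto)
  then show ?thesis by blast
qed

text \<open>Fix a vertex \<open>x\<close>. Every member has an edge at \<open>x\<close>, and the
  other end of that edge determines the member. This bounds the number of graphs to be completed in
  the sufficiency proof.\<close>

lemma OP_solution_lepoll:
  assumes sol: "OP_solution F V \<FF>" and F: "simple_graph F" "regular k F" "k > 0" and "V \<noteq> {}"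
  shows "\<FF> \<lesssim> V"
proof -
  obtain x where x: "x \<in> V" using \<open>V \<noteq> {}\<close> by blast
  have "\<exists>y. {x, y} \<in> edges G" if "G \<in> \<FF>" for G
    using OP_solution_member_regular[OF sol that F(1,2)] ex_neighbour F(3) x by metis
  then obtain f where f: "\<And>G. G \<in> \<FF> \<Longrightarrow> {x, f G} \<in> edges G" by metis
  have fV: "f G \<in> V" "x \<noteq> f G" if "G \<in> \<FF>" for G
    using OP_solution_member_regular[OF sol that F(1,2)] simple_graph_edge[OF _ f[OF that]] by auto
  have "inj_on f \<FF>"
  proof (rule inj_onI)
    fix G H assume GH: "G \<in> \<FF>" "H \<in> \<FF>" "f G = f H"
    then have "{x, f G} \<in> edges H" using f by simp
    then show "G = H"
      using OP_solution_edge[OF sol x fV[OF GH(1)]] f GH by blast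
  qed
  then show ?thesis using fV unfolding lepoll_def by blast
qed

section \<open>Necessity\<close>

lemma subsystem_imp_copy:
  assumes F: "simple_graph F" "regular k F" "infinite (verts F)"
    and L: "simple_graph L" "regular k L" "infinite (verts L)" and "k > 0"
    and sol: "OP_solution F V \<FF>" and sub: "subsystem L V \<FF> \<LL>"
  shows "\<exists>L'. subgraph L' F \<and> isomorphic L' L \<and> (L' = F \<or> verts F - verts L' \<approx> verts F)"
proof -
  obtain W where W: "W \<subseteq> V" and solW: "OP_solution L W \<LL>" and \<LL>: "\<LL> = restriction \<FF> W"
    using sub unfolding subsystem_def by blast
  have VF: "V \<approx> verts F" using sol unfolding OP_solution_alt by blast
  then have infV: "infinite V" using F(3) eqpoll_finite_iff by blast
  have infW: "infinite W" using solW L(3) eqpoll_finite_iff unfolding OP_solution_alt by blast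
  obtain a where a: "a \<in> W" using infW by (metis ex_in_conv finite.emptyI)
  obtain b where b: "b \<in> W" "b \<noteq> a" using infW by (metis finite.emptyI finite_insert finite_subset insertCI subsetI)
  obtain H where H: "H \<in> \<LL>"
    using OP_solution_edge[OF solW a b(1)] b(2) by auto
  then obtain G where G: "G \<in> \<FF>" and HG: "H = induced_subgraph G W"
    unfolding \<LL> restriction_def by blast
  note Hreg = OP_solution_member_regular[OF solW H L(1,2)]
  note Greg = OP_solution_member_regular[OF sol G F(1,2)]
  \<comment> \<open>Carrying \<open>G\<close> onto \<open>F\<close> by \<open>h\<close> carries its
    induced subgraph \<open>H\<close>, a copy of \<open>L\<close>, onto the required
    \<open>L'\<close>.\<close>
  obtain h where h: "inj_on h (verts G)" and Fh: "F = image_graph h G"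
    using isomorphicE[OF isomorphic_sym[OF Greg(3)] Greg(1) F(1)] by blast
  define L' where "L' = image_graph h H"
  have "inj_on h (verts H)" using h Hreg(2) Greg(2) W by (auto intro: inj_on_subset)
  then have "simple_graph L'" "isomorphic H L'"
    unfolding L'_def using Hreg(1) by (auto intro: simple_graph_image_graph isomorphic_image_graph)
  moreover have "verts L' \<subseteq> verts F" "edges L' \<subseteq> edges F"
    unfolding L'_def Fh HG by (auto simp: image_graph_def induced_subgraph_def)
  ultimately have "subgraph L' F" "isomorphic L' L"
    using Hreg(3) isomorphic_sym isomorphic_trans unfolding subgraph_def by blast+
  moreover have "L' = F \<or> verts F - verts L' \<approx> verts F"
  proof (cases "W = V")
    case True
    have "e \<subseteq> V" if "e \<in> edges G" for e using that Greg(1,2) by (auto simp: simple_graph_def)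
    then have "H = G" unfolding HG True using Greg(2) by (cases G) (auto simp: induced_subgraph_def)
    then show ?thesis by (simp add: L'_def Fh)
  next
    case False
    then obtain x where x: "x \<in> V" "x \<notin> W" using W by blast
    have "a \<in> V" "a \<noteq> x" using a W x by auto
    then obtain G' where G': "G' \<in> \<FF>" and ax: "{a, x} \<in> edges G'"
      using OP_solution_edge[OF sol _ x(1)] by blast
    note G'reg = OP_solution_member_regular[OF sol G' F(1,2)]
    \<comment> \<open>Otherwise the induced graph would be a \<open>k\<close>-regular member of
      \<open>\<LL>\<close> and contain all edges of \<open>G'\<close> at \<open>a\<close>, including
      the one to \<open>x\<close> outside \<open>W\<close>.\<close>
    have no_edge: "edges (induced_subgraph G' W) = {}"
    proof (rule ccontr)
      assume "edges (induced_subgraph G' W) \<noteq> {}"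
      then have "induced_subgraph G' W \<in> \<LL>" using G' unfolding \<LL> restriction_def by blast
      note reg = OP_solution_member_regular[OF solW this L(1,2)]
      have "{y. {a, y} \<in> edges (induced_subgraph G' W)} = {y. {a, y} \<in> edges G'}"
      proof (rule neighbour_sets_eq[OF reg(1,4) G'reg(1,4) \<open>k > 0\<close>])
        show "edges (induced_subgraph G' W) \<subseteq> edges G'" by (auto simp: induced_subgraph_def)
        show "a \<in> verts (induced_subgraph G' W)" using reg(2) a by simp
        show "a \<in> verts G'" using G'reg(2) \<open>a \<in> V\<close> by simp
      qed
      then have "{a, x} \<in> edges (induced_subgraph G' W)" using ax by blast
      then show False using x by (simp add: induced_subgraph_def)
    qed
  \<comment> \<open>Since \<open>G'\<close> has no edge inside \<open>W\<close>, all neighbours of \<open>W\<close> lie in \<open>V - W\<close>.\<close>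
      have "V \<subseteq> (\<Union>y\<in>V - W. insert y {w. {y, w} \<in> edges G'})"
    proof
      fix w assume w: "w \<in> V"
      show "w \<in> (\<Union>y\<in>V - W. insert y {w. {y, w} \<in> edges G'})"
      proof (cases "w \<in> W")
        case True
        obtain y where y: "{w, y} \<in> edges G'"
          using ex_neighbour[OF G'reg(1,4) \<open>k > 0\<close>] G'reg(2) w by blast
        then have "y \<in> V" using simple_graph_edge[OF G'reg(1)] G'reg(2) by blast
        moreover have "y \<notin> W" using y no_edge True by (auto simp: induced_subgraph_def)
        ultimately show ?thesis using y by (intro UN_I[of y]) (auto simp: insert_commute)
      qed (use w in auto)
    qed
    then have *: "V \<lesssim> (\<Union>y\<in>V - W. insert y {w. {y, w} \<in> edges G'})"
      by (rule subset_imp_lepoll)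
    have fin: "finite (insert y {w. {y, w} \<in> edges G'})" for y
      using finite_neighbours[OF G'reg(1,4) \<open>k > 0\<close>] by simp
    \<comment> \<open>Fewer than \<open>|V|\<close> finite sets would have a union smaller than
      \<open>V\<close>, but this union contains \<open>V\<close>.\<close>
    have "\<not> V - W \<prec> V"
      using UN_finite_lesspoll[OF infV, of "V - W" "\<lambda>y. insert y {w. {y, w} \<in> edges G'}"] fin *
      by (meson lesspoll_def lesspoll_trans1 lesspoll_not_refl)
    then have "V - W \<approx> V"
      using lepoll_iff_leqpoll subset_imp_lepoll by (metis Diff_subset)
    moreover have "verts F - verts L' = h ` (V - W)"
      using h Greg(2) Hreg(2) W unfolding L'_def Fh image_graph_def
      by (simp add: inj_on_image_set_diff)
    moreover have "h ` (V - W) \<approx> V - W"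
      using h Greg(2) by (intro inj_on_image_eqpoll_self) (auto intro: inj_on_subset)
    ultimately show ?thesis using VF by (metis eqpoll_trans)
  qed
  ultimately show ?thesis by blast
qed

section \<open>Sufficiency for a copy with large complement\<close>

lemma copy_imp_subsystem:
  assumes F: "simple_graph F" "regular k F" "infinite (verts F)"
    and L: "simple_graph L" "regular k L" "infinite (verts L)" and k: "k > 0"
    and VF: "V \<approx> verts F"
    and L': "subgraph L' F" "isomorphic L' L" and diff: "verts F - verts L' \<approx> verts F"
  shows "\<exists>\<FF> \<LL>. OP_solution F V \<FF> \<and> subsystem L V \<FF> \<LL>"
proof -
  have sL': "simple_graph L'" and vL': "verts L' \<subseteq> verts F" and eL': "edges L' \<subseteq> edges F"
    using L'(1) unfolding subgraph_def by auto
  have rL': "regular k L'" using regular_isomorphic isomorphic_sym L' L sL' by blast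
  have infV: "infinite V" using VF F(3) eqpoll_finite_iff by blast
  obtain g where g: "bij_betw g (verts F) V" using VF eqpoll_sym unfolding eqpoll_def by blast
  define W where "W = g ` verts L'"
  have gi: "inj_on g (verts F)" and gV: "g ` verts F = V" using g by (auto simp: bij_betw_def)
  have W: "W \<subseteq> V" unfolding W_def using gV vL' by blast
  have "V - W = g ` (verts F - verts L')"
    unfolding W_def using gi gV vL' by (metis inj_on_image_set_diff order_refl Diff_subset)
  then have VW_diff: "V - W \<approx> verts F - verts L'"
    using gi by (metis Diff_subset inj_on_image_eqpoll_self inj_on_subset)
  then have VW: "V \<approx> V - W" using VF diff by (meson eqpoll_sym eqpoll_trans)
  have "W \<approx> verts L'" unfolding W_def
    using gi vL' by (meson inj_on_image_eqpoll_self inj_on_subset)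
  moreover have "verts L' \<approx> verts L" using L'(2) unfolding isomorphic_def eqpoll_def by blast
  ultimately have WL: "W \<approx> verts L" by (rule eqpoll_trans)
  then have W_ne: "W \<noteq> {}" using L(3) eqpoll_finite_iff by blast
  obtain \<LL> where \<LL>: "OP_solution L W \<LL>" using OP_solution_exists[OF L(1,2) k L(3) WL] by blast
  have \<LL>_le: "\<LL> \<lesssim> V"
    using OP_solution_lepoll[OF \<LL> L(1,2) k W_ne] W by (meson lepoll_trans subset_imp_lepoll)
  define R where "R = induced_subgraph F (verts F - verts L')"
  have vR: "verts R = verts F - verts L'" by (auto simp: R_def induced_subgraph_def)
  have sR: "simple_graph R" using F(1) by (auto simp: R_def induced_subgraph_def simple_graph_def)
  have eR: "edges R \<subseteq> edges F" by (auto simp: R_def induced_subgraph_def)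
  \<comment> \<open>By regularity no edge of \<open>F\<close> joins the copy to its complement, so
    \<open>F\<close> is the disjoint union of \<open>L'\<close> and \<open>R\<close> and can be
    embedded piecewise.\<close>
  have eF: "edges F = edges L' \<union> edges R"
  proof (intro equalityI subsetI)
    fix e assume e: "e \<in> edges F"
    then obtain x y where xy: "e = {x, y}" "x \<in> verts F" "y \<in> verts F"
      using simple_graph_edgeE[OF F(1)] by metis
    have "{u, v} \<in> edges L'" if "{u, v} \<in> edges F" "u \<in> verts L'" for u v
      using neighbour_sets_eq[OF sL' rL' F(1,2) k eL' that(2)] that vL' by blast
    from this[of x y] this[of y x] show "e \<in> edges L' \<union> edges R"
      using e xy by (auto simp: R_def induced_subgraph_def insert_commute)
  qed (use eL' eR in auto)
  obtain x where "x \<in> verts F" using F(3) by fastforce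
  then have neF: "edges F \<noteq> {}" using ex_neighbour[OF F(1,2) k] by (metis empty_iff)
  \<comment> \<open>The index \<open>Inl H\<close> stands for the completion of \<open>H\<close> to a copy of \<open>F\<close> by a copy of \<open>R\<close>
    on \<open>V - W\<close>, the index \<open>Inr v\<close> for a copy of \<open>F\<close> without edges inside \<open>W\<close>.\<close>
  define I where "I = \<LL> <+> V"
  define \<Phi> :: "'c graph + 'c \<Rightarrow> 'a graph" where "\<Phi> = case_sum (\<lambda>_. R) (\<lambda>_. F)"
  define B :: "'c graph + 'c \<Rightarrow> 'c set" where "B = case_sum (\<lambda>_. V - W) (\<lambda>_. V)"
  interpret edge_packing I \<Phi> B V W
  proof
    show "V \<lesssim> V - W" using VW by (rule eqpoll_imp_lepoll)
    show "I \<lesssim> V" unfolding I_def Plus_def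
      using \<LL>_le by (intro Un_lepoll_infinite infV) (meson image_lepoll lepoll_trans)+
    show "simple_graph (\<Phi> i)" if "i \<in> I" for i
      using sR F(1) by (auto simp: \<Phi>_def split: sum.split)
    have "finite {y. {x, y} \<in> edges F}" for x using finite_neighbours[OF F(1,2) k] .
    moreover have "{y. {x, y} \<in> edges R} \<subseteq> {y. {x, y} \<in> edges F}" for x using eR by blast
    ultimately show "finite {y. {x, y} \<in> edges (\<Phi> i)}" for i x
      by (auto simp: \<Phi>_def intro: finite_subset split: sum.split)
    show "verts (\<Phi> i) \<approx> V" for i
      using VF diff vR by (auto simp: \<Phi>_def split: sum.split intro: eqpoll_trans eqpoll_sym)
    show "V - W \<subseteq> B i \<and> B i \<subseteq> V" for i by (auto simp: B_def split: sum.split)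
    have "Inr ` V \<subseteq> {i \<in> I. B i = V \<and> edges (\<Phi> i) \<noteq> {}}"
      using neF by (auto simp: I_def B_def \<Phi>_def)
    moreover have "V \<lesssim> Inr ` V" by (simp add: inj_on_def)
    ultimately show "V \<lesssim> {i \<in> I. B i = V \<and> edges (\<Phi> i) \<noteq> {}}"
      by (meson lepoll_trans subset_imp_lepoll)
  qed (use infV W in auto)
  obtain \<phi> where \<phi>_bij: "\<And>i. i \<in> I \<Longrightarrow> bij_betw (\<phi> i) (verts (\<Phi> i)) (B i)"
    and \<phi>_cov: "\<And>e. e \<subseteq> V \<Longrightarrow> card e = 2 \<Longrightarrow> \<not> e \<subseteq> W \<Longrightarrow> \<exists>!i. i \<in> I \<and> e \<in> edges (image_graph (\<phi> i) (\<Phi> i))"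
    and \<phi>_out: "\<And>i e. i \<in> I \<Longrightarrow> e \<in> edges (image_graph (\<phi> i) (\<Phi> i)) \<Longrightarrow> \<not> e \<subseteq> W"
    using packing_exists by metis
  \<comment> \<open>The edges that \<open>G i\<close> has inside \<open>W\<close>: those of
    \<open>H\<close> for \<open>Inl H\<close>, none for \<open>Inr v\<close>.\<close>
  define inner :: "'c graph + 'c \<Rightarrow> 'c set set" where "inner = case_sum edges (\<lambda>_. {})"
  define G where "G i = Graph V (inner i \<union> edges (image_graph (\<phi> i) (\<Phi> i)))" for i
  have inner_W: "e \<subseteq> W" if "e \<in> inner i" "i \<in> I" for e i
    using that \<LL> unfolding OP_solution_alt
    by (auto simp: inner_def I_def simple_graph_def split: sum.splits)
  have G_image: "\<exists>\<psi>. inj_on \<psi> (verts F) \<and> G i = image_graph \<psi> F" if i: "i \<in> I" for i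
  proof (cases i)
    case (Inr v)
    then have "bij_betw (\<phi> i) (verts F) V" using \<phi>_bij[OF i] by (simp add: \<Phi>_def B_def)
    moreover then have "G i = image_graph (\<phi> i) F"
      using Inr by (auto simp: G_def inner_def \<Phi>_def image_graph_def bij_betw_def)
    ultimately show ?thesis by (auto simp: bij_betw_def)
  next
    case (Inl H)
    then have H: "H \<in> \<LL>" using i by (auto simp: I_def)
    have sH: "simple_graph H" and vH: "verts H = W" and "isomorphic L H"
      using OP_solution_member_regular[OF \<LL> H L(1,2)] by auto
    then obtain h where h: "inj_on h (verts L')" and Hh: "H = image_graph h L'"
      using isomorphicE[OF _ sL' sH] isomorphic_trans L'(2) by blast
    have hW: "h ` verts L' = W" using vH by (simp add: Hh image_graph_def)
    have \<phi>: "inj_on (\<phi> i) (verts R)" "\<phi> i ` verts R = V - W"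
      using \<phi>_bij[OF i] by (auto simp: \<Phi>_def B_def Inl bij_betw_def)
    \<comment> \<open>Glue \<open>h\<close>, which maps \<open>L'\<close> onto \<open>H\<close>,
      with the packed embedding of \<open>R\<close>. Their ranges \<open>W\<close> and
      \<open>V - W\<close> are disjoint and exhaust \<open>V\<close>.\<close>
    define \<psi> where "\<psi> x = (if x \<in> verts L' then h x else \<phi> i x)" for x
    have \<psi>L: "\<psi> ` e = h ` e" if "e \<subseteq> verts L'" for e using that by (auto simp: \<psi>_def)
    have \<psi>R: "\<psi> ` e = \<phi> i ` e" if "e \<subseteq> verts R" for e
      using that vR by (intro image_cong) (auto simp: \<psi>_def)
    have vF: "verts F = verts L' \<union> verts R" using vR vL' by blast
    have "inj_on \<psi> (verts L')" "inj_on \<psi> (verts R)"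
      using h \<phi>(1) vR by (auto simp: inj_on_def \<psi>_def)
    then have "inj_on \<psi> (verts F)"
      unfolding vF inj_on_Un using \<psi>L[of "verts L'"] \<psi>R[of "verts R"] hW \<phi>(2)
      by (metis Diff_disjoint Diff_subset image_mono inf_mono subset_empty order_refl)
    moreover have "\<psi> ` verts F = V"
      unfolding vF image_Un using \<psi>L[of "verts L'"] \<psi>R[of "verts R"] hW \<phi>(2) W by auto
    moreover have "image \<psi> ` edges L' = image h ` edges L'"
      by (rule image_cong[OF refl], rule \<psi>L) (use sL' in \<open>simp add: simple_graph_def\<close>)
    moreover have "image \<psi> ` edges R = image (\<phi> i) ` edges R"
      by (rule image_cong[OF refl], rule \<psi>R) (use sR in \<open>simp add: simple_graph_def\<close>)
    ultimately have "inj_on \<psi> (verts F) \<and> G i = image_graph \<psi> F"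
      unfolding G_def by (simp add: Inl inner_def \<Phi>_def Hh image_graph_def eF image_Un)
    then show ?thesis by blast
  qed
  have sol: "OP_solution F V (G ` I)"
  proof (rule OP_solution_indexed[OF VF])
    show "simple_graph (G i) \<and> verts (G i) = V \<and> isomorphic F (G i)" if "i \<in> I" for i
    proof -
      obtain \<psi> where "inj_on \<psi> (verts F)" "G i = image_graph \<psi> F" using G_image \<open>i \<in> I\<close> by blast
      then have "simple_graph (G i)" "isomorphic F (G i)"
        using simple_graph_image_graph isomorphic_image_graph F(1) by metis+
      then show ?thesis by (simp add: G_def)
    qed
    show "\<exists>!i. i \<in> I \<and> e \<in> edges (G i)" if e: "e \<subseteq> V" "card e = 2" for e
    proof (cases "e \<subseteq> W")
      case True
      \<comment> \<open>Packed edges are never inside \<open>W\<close>, so such an \<open>e\<close>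
        can come only from an \<open>inner\<close> part, and \<open>\<LL>\<close> decides
        which.\<close>
      then have "i \<in> I \<and> e \<in> edges (G i) \<longleftrightarrow> (\<exists>H\<in>\<LL>. i = Inl H \<and> e \<in> edges H)" for i
        using \<phi>_out[of i e] by (cases i) (auto simp: G_def I_def inner_def)
      moreover have "\<exists>!H. H \<in> \<LL> \<and> e \<in> edges H"
        using \<LL> True e(2) unfolding OP_solution_alt by blast
      ultimately show ?thesis by auto
    next
      case False
      then have "i \<in> I \<and> e \<in> edges (G i) \<longleftrightarrow> i \<in> I \<and> e \<in> edges (image_graph (\<phi> i) (\<Phi> i))" for i
        using inner_W by (auto simp: G_def)
      then show ?thesis using \<phi>_cov[OF e False] by simp
    qed
  qed
  \<comment> \<open>Inducing on \<open>W\<close> removes exactly the packed edges. For an index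
    \<open>Inr v\<close> nothing remains, and \<open>restriction\<close> discards the graph.\<close>
  have ind: "induced_subgraph (G i) W = Graph W (inner i)" if "i \<in> I" for i
    using inner_W that \<phi>_out W by (auto simp: induced_subgraph_def G_def)
  have "restriction (G ` I) W = \<LL>"
  proof (intro equalityI subsetI)
    fix H assume "H \<in> restriction (G ` I) W"
    then obtain i where "i \<in> I" "H = induced_subgraph (G i) W" "edges H \<noteq> {}"
      unfolding restriction_def by blast
    then have i: "i \<in> I" "H = Graph W (inner i)" "inner i \<noteq> {}"
      using ind[of i] by simp_all
    then obtain H' where "i = Inl H'" "H' \<in> \<LL>" by (auto simp: I_def inner_def)
    moreover then have "verts H' = W" using \<LL> unfolding OP_solution_alt by blast
    ultimately show "H \<in> \<LL>" using i by (cases H') (auto simp: inner_def)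
  next
    fix H assume H: "H \<in> \<LL>"
    note reg = OP_solution_member_regular[OF \<LL> H L(1,2)]
    \<comment> \<open>Positive degree gives \<open>H\<close> an edge, so \<open>restriction\<close>
      keeps it.\<close>
    obtain x where "x \<in> verts H" using reg(2) W_ne by blast
    then obtain y where "{x, y} \<in> edges H" using ex_neighbour[OF reg(1,4) k] by blast
    then have "edges H \<noteq> {}" by blast
    moreover have "induced_subgraph (G (Inl H)) W = H"
      using ind[of "Inl H"] H reg(2) by (cases H) (auto simp: I_def inner_def)
    moreover have "Inl H \<in> I" using H by (auto simp: I_def)
    ultimately show "H \<in> restriction (G ` I) W"
      unfolding restriction_def by (intro CollectI) (metis image_eqI)
  qed
  then have "subsystem L V (G ` I) \<LL>" using W \<LL> unfolding subsystem_def by blast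
  then show ?thesis using sol by blast
qed

theorem theorem4p7:
  fixes F :: "'a graph" and L :: "'b graph" and V :: "'v set"
  assumes "simple_graph F" and "regular 2 F" and "infinite (verts F)"
    and "simple_graph L" and "regular 2 L" and "infinite (verts L)"
    and "V \<approx> verts F"
  shows "(\<exists>\<FF>. OP_solution F V \<FF> \<and> (\<exists>\<LL>. subsystem L V \<FF> \<LL>)) \<longleftrightarrow>
    (\<exists>L'. subgraph L' F \<and> isomorphic L' L \<and>
       (L' = F \<or> verts F - verts L' \<approx> verts F))"
proof
  assume "\<exists>\<FF>. OP_solution F V \<FF> \<and> (\<exists>\<LL>. subsystem L V \<FF> \<LL>)"
  then show "\<exists>L'. subgraph L' F \<and> isomorphic L' L \<and> (L' = F \<or> verts F - verts L' \<approx> verts F)"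
    using subsystem_imp_copy[OF assms(1-6) zero_less_numeral] by blast
next
  assume "\<exists>L'. subgraph L' F \<and> isomorphic L' L \<and> (L' = F \<or> verts F - verts L' \<approx> verts F)"
  then obtain L' where L': "subgraph L' F" "isomorphic L' L"
    and "L' = F \<or> verts F - verts L' \<approx> verts F" by blast
  then show "\<exists>\<FF>. OP_solution F V \<FF> \<and> (\<exists>\<LL>. subsystem L V \<FF> \<LL>)"
  proof (elim disjE)
    assume "verts F - verts L' \<approx> verts F"
    then show ?thesis
      using copy_imp_subsystem[OF assms(1-6) _ assms(7) L'] by auto
  next
    \<comment> \<open>Now \<open>F\<close> and \<open>L\<close> are isomorphic, and any solution is
      its own subsystem with \<open>W = V\<close>.\<close>
    assume "L' = F"
    with L'(2) have FL: "isomorphic F L" by simp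
    obtain \<FF> where \<FF>: "OP_solution F V \<FF>"
      using OP_solution_exists[OF assms(1,2) _ assms(3,7)] by auto
    have "verts F \<approx> verts L" using FL unfolding isomorphic_def eqpoll_def by blast
    then have "V \<approx> verts L" using assms(7) by (metis eqpoll_trans)
    moreover have "isomorphic G L" if "G \<in> \<FF>" for G
      using \<FF> that FL isomorphic_trans[of G F L] unfolding OP_solution_alt by blast
    ultimately have "OP_solution L V \<FF>"
      using \<FF> unfolding OP_solution_alt by simp
    moreover have "restriction \<FF> V = \<FF>"
    proof -
      have ind: "induced_subgraph G V = G" "edges G \<noteq> {}" if "G \<in> \<FF>" for G
      proof -
        note G = OP_solution_member_regular[OF \<FF> that assms(1,2)]
        have "V \<noteq> {}" using assms(3,7) eqpoll_finite_iff by blast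
        then obtain x where "x \<in> verts G" using G(2) by blast
        then obtain y where "{x, y} \<in> edges G" using ex_neighbour[OF G(1,4)] by auto
        then show "edges G \<noteq> {}" by blast
        have "e \<subseteq> V" if "e \<in> edges G" for e
          using that G(1,2) by (simp add: simple_graph_def)
        then show "induced_subgraph G V = G"
          using G(2) by (cases G) (auto simp: induced_subgraph_def)
      qed
      show ?thesis
      proof (intro equalityI subsetI)
        show "H \<in> \<FF>" if "H \<in> restriction \<FF> V" for H
          using that ind(1) unfolding restriction_def by auto
        show "H \<in> restriction \<FF> V" if "H \<in> \<FF>" for H
          using that ind[OF that] unfolding restriction_def by (intro CollectI) metis
      qed
    qed
    ultimately show ?thesis using \<FF> unfolding subsystem_def by blast
  qed
qed

end
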